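(* Let $n\ge1$ and $r\ge2$. The number $N_{n,r}^D$ of ordered $r$-tuples $(\pi_1,\ldots,\pi_r)$ of $B_n$-partitions without zero-block that intersect minimally equals \[ N_{n,r}^D=\frac{2^n}{e^{r/2}}\sum_{k_1,k_2,\ldots,k_r\ge0}\frac{\left(2^{r-1}k_1k_2\cdots k_r\right)_n}{(2k_1)!!\,(2k_2)!!\cdots(2k_r)!!}. \]
   Context: Let $[\pm n]=\{\pm1,\ldots,\pm n\}$. A $B_n$-partition is a partition of $[\pm n]$ into blocks such that (i) for every block $B$, $-B=\{-b:b\in B\}$ is also a block, and (ii) there is at most one block $B$ with $B=-B$, called the zero-block. The meet $\pi_1\wedge\cdots\wedge\pi_r$ (in the refinement order) is the partition whose blocks are the nonempty intersections $B_1\cap\cdots\cap B_r$ with $B_t$ a block of $\pi_t$; $\hat0^B=\{\{1\},\{-1\},\ldots,\{n\},\{-n\}\}$. The partitions intersect minimally if their meet is $\hat0^B$. $(x)_n=x(x-1)\cdots(x-n+1)$; $(2m)!!=2^m m!$, $0!!=1$. *)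

theory Defs
  imports "HOL-Analysis.Analysis" "HOL-Library.Disjoint_Sets"
begin

definition pm_set :: "nat \<Rightarrow> int set" where
  "pm_set n = {x. 1 \<le> \<bar>x\<bar> \<and> \<bar>x\<bar> \<le> int n}"

definition zero_block :: "int set set \<Rightarrow> int set \<Rightarrow> bool" where
  "zero_block P B \<longleftrightarrow> B \<in> P \<and> uminus ` B = B"

definition B_partition :: "nat \<Rightarrow> int set set \<Rightarrow> bool" where
  "B_partition n P \<longleftrightarrow> partition_on (pm_set n) P
     \<and> (\<forall>B\<in>P. uminus ` B \<in> P)
     \<and> (\<forall>B C. zero_block P B \<longrightarrow> zero_block P C \<longrightarrow> B = C)"

definition B_partitions_no_zero :: "nat \<Rightarrow> int set set set" where
  "B_partitions_no_zero n = {P. B_partition n P \<and> (\<nexists>B. zero_block P B)}"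

definition B_bottom :: "nat \<Rightarrow> int set set" where
  "B_bottom n = (\<lambda>x. {x}) ` pm_set n"

text \<open>The meet of a tuple of partitions is the library's \<^const>\<open>common_refinement\<close> of the
  set of its entries. Forgetting repeated entries does not change the nonempty intersections of
  one block from each entry, because two blocks of the same partition are equal or disjoint.\<close>

definition tuple_meet :: "nat \<Rightarrow> (nat \<Rightarrow> 'a set set) \<Rightarrow> 'a set set" where
  "tuple_meet r p = common_refinement (p ` {1..r})"

lemma tuple_meet_eq:
  assumes "\<And>t. t \<in> {1..r} \<Longrightarrow> partition_on A (p t)"
  shows "tuple_meet r p = {\<Inter>t\<in>{1..r}. B t |B. \<forall>t\<in>{1..r}. B t \<in> p t} - {{}}" (is "_ = ?R")
proof
  show "tuple_meet r p \<subseteq> ?R"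
  proof
    fix X assume "X \<in> tuple_meet r p"
    then obtain f where f: "f \<in> (\<Pi> P\<in>p ` {1..r}. P)" "X = \<Inter> (f ` p ` {1..r})" "X \<noteq> {}"
      by (auto simp: tuple_meet_def common_refinement)
    show "X \<in> ?R"
      using f by (auto simp: image_image intro!: exI[of _ "\<lambda>t. f (p t)"])
  qed
  show "?R \<subseteq> tuple_meet r p"
  proof
    fix X assume "X \<in> ?R"
    then obtain B where B: "\<forall>t\<in>{1..r}. B t \<in> p t" "X = (\<Inter>t\<in>{1..r}. B t)" "X \<noteq> {}"
      by auto
    then obtain x where x: "x \<in> X" by auto
    define f where "f P = (THE C. C \<in> P \<and> x \<in> C)" for P
    have fB: "f (p t) = B t" if t: "t \<in> {1..r}" for t
      unfolding f_def
    proof (rule the_equality)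
      show "B t \<in> p t \<and> x \<in> B t" using B x t by auto
      show "C = B t" if C: "C \<in> p t \<and> x \<in> C" for C
      proof -
        have "B t \<in> p t" "x \<in> B t" using B x t by auto
        then show ?thesis
          using C partition_onD2[OF assms[OF t]] unfolding disjoint_def by blast
      qed
    qed
    have "f \<in> (\<Pi> P\<in>p ` {1..r}. P)" using fB B by auto
    moreover have "X = \<Inter> (f ` p ` {1..r})" using fB B by (auto simp: image_image)
    ultimately show "X \<in> tuple_meet r p"
      using B(3) by (auto simp: tuple_meet_def common_refinement)
  qed
qed

text \<open>Ordered tuples indexed by \<open>1, \<dots>, r\<close> are extensional functions on \<open>{1..r}\<close>.\<close>

definition min_intersecting_tuples :: "nat \<Rightarrow> nat \<Rightarrow> (nat \<Rightarrow> int set set) set" where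
  "min_intersecting_tuples n r =
     {p \<in> {1..r} \<rightarrow>\<^sub>E B_partitions_no_zero n. tuple_meet r p = B_bottom n}"

definition N_D :: "nat \<Rightarrow> nat \<Rightarrow> nat" where
  "N_D n r = card (min_intersecting_tuples n r)"

lemma finite_min_intersecting_tuples: "finite (min_intersecting_tuples n r)"
proof -
  have "pm_set n \<subseteq> {- int n..int n}" by (auto simp: pm_set_def)
  then have "finite (pm_set n)" by (rule finite_subset) simp
  then have "finite (B_partitions_no_zero n)"
    using finitely_many_partition_on
    by (rule_tac finite_subset[of _ "{P. partition_on (pm_set n) P}"])
       (auto simp: B_partitions_no_zero_def B_partition_def)
  then have "finite ({1..r} \<rightarrow>\<^sub>E B_partitions_no_zero n)" by (intro finite_PiE) auto
  then show ?thesis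
    by (rule finite_subset[rotated]) (auto simp: min_intersecting_tuples_def)
qed

definition falling_fact :: "real \<Rightarrow> nat \<Rightarrow> real" where
  "falling_fact x n = (\<Prod>i<n. (x - real i))"

fun double_fact :: "nat \<Rightarrow> nat" where
  "double_fact 0 = 1"
| "double_fact (Suc 0) = 1"
| "double_fact (Suc (Suc m)) = Suc (Suc m) * double_fact m"

lemma double_fact_even: "double_fact (2 * m) = 2 ^ m * fact m"
  by (induction m) (auto simp: algebra_simps)

end

theory Submission
  imports Defs
begin

text \<open>A \<open>B\<^sub>n\<close>-partition without zero-block is the partition into fibres of an odd map
  \<open>[\<plusminus>n] \<rightarrow> [\<plusminus>k]\<close>. If it has \<open>2m\<close> blocks, it arises from \<open>2k(2k-2)\<cdots>(2k-2m+2)\<close> such maps, and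
  weighting \<open>k\<close> by \<open>1/(2k)!!\<close> these counts sum to \<open>e\<^sup>1\<^sup>/\<^sup>2\<close>, independently of the partition.
  Hence \<open>e\<^sup>r\<^sup>/\<^sup>2 N\<close> is the weighted number of \<open>r\<close>-tuples of odd maps whose fibre partitions intersect
  minimally. Minimality means that the joint map into \<open>[\<plusminus>k\<^sub>1] \<times> \<cdots> \<times> [\<plusminus>k\<^sub>r]\<close> is injective, and both
  counts are instances of one: the number of injections commuting with given fixed-point-free
  involutions.\<close>

section \<open>Injections commuting with fixed-point-free involutions\<close>

text \<open>The conditions are imposed on \<open>A\<close> only: pointwise negation of tuples,
  written with a restricted lambda, is an involution on extensional functions but not on all
  functions.\<close>

definition free_involution_on :: "('a \<Rightarrow> 'a) \<Rightarrow> 'a set \<Rightarrow> bool" where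
  "free_involution_on \<tau> A \<longleftrightarrow> (\<forall>x\<in>A. \<tau> x \<in> A \<and> \<tau> (\<tau> x) = x \<and> \<tau> x \<noteq> x)"

lemma free_involution_onD:
  assumes "free_involution_on \<tau> A" "x \<in> A"
  shows "\<tau> x \<in> A" "\<tau> (\<tau> x) = x" "\<tau> x \<noteq> x"
  using assms by (auto simp: free_involution_on_def)

lemma free_involution_on_remove:
  assumes "free_involution_on \<tau> A" "x \<in> A"
  shows "free_involution_on \<tau> (A - {x, \<tau> x})"
proof -
  note D = free_involution_onD[OF assms(1)]
  have "\<tau> y \<noteq> x \<and> \<tau> y \<noteq> \<tau> x" if "y \<in> A - {x, \<tau> x}" for y
    using that D(2)[of y] D(2)[OF assms(2)] by force
  then show ?thesis using D by (simp add: free_involution_on_def)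
qed

text \<open>With negation on both sides these are the odd maps. Extensionality makes each map on
  \<open>A\<close> count once, so \<open>card\<close> is meaningful.\<close>

definition equivariant_maps :: "('a \<Rightarrow> 'a) \<Rightarrow> 'a set \<Rightarrow> ('b \<Rightarrow> 'b) \<Rightarrow> 'b set \<Rightarrow> ('a \<Rightarrow> 'b) set" where
  "equivariant_maps \<tau> A \<sigma> T = {f \<in> A \<rightarrow>\<^sub>E T. \<forall>x\<in>A. f (\<tau> x) = \<sigma> (f x)}"

definition equivariant_injections :: "('a \<Rightarrow> 'a) \<Rightarrow> 'a set \<Rightarrow> ('b \<Rightarrow> 'b) \<Rightarrow> 'b set \<Rightarrow> ('a \<Rightarrow> 'b) set" where
  "equivariant_injections \<tau> A \<sigma> T = {f \<in> equivariant_maps \<tau> A \<sigma> T. inj_on f A}"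

lemma equivariant_mapsD:
  assumes "f \<in> equivariant_maps \<tau> A \<sigma> T"
  shows "f \<in> A \<rightarrow>\<^sub>E T" "\<And>x. x \<in> A \<Longrightarrow> f x \<in> T" "\<And>x. x \<in> A \<Longrightarrow> f (\<tau> x) = \<sigma> (f x)"
  using assms by (auto simp: equivariant_maps_def)

lemma finite_equivariant_maps:
  "finite A \<Longrightarrow> finite T \<Longrightarrow> finite (equivariant_maps \<tau> A \<sigma> T)"
  unfolding equivariant_maps_def by (rule finite_subset[OF _ finite_PiE[of A "\<lambda>_. T"]]) auto

lemma finite_equivariant_injections:
  "finite A \<Longrightarrow> finite T \<Longrightarrow> finite (equivariant_injections \<tau> A \<sigma> T)"
  by (simp add: equivariant_injections_def finite_equivariant_maps)

text \<open>The value \<open>t\<close> at \<open>x\<close> forces the value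
  \<open>\<sigma> t\<close> at \<open>\<tau> x\<close>. Since the image of \<open>A'\<close> is
  closed under \<open>\<sigma>\<close>, it avoids \<open>\<sigma> t\<close> as soon as it avoids
  \<open>t\<close>; and \<open>\<sigma> t\<close> differs from \<open>t\<close>. So each equivariant
  injection on \<open>A'\<close> extends once for every \<open>t\<close> in \<open>T\<close> outside
  its image.\<close>

lemma card_equivariant_injections_remove:
  fixes \<tau> :: "'a \<Rightarrow> 'a" and \<sigma> :: "'b \<Rightarrow> 'b"
  assumes \<tau>: "free_involution_on \<tau> A" and \<sigma>: "free_involution_on \<sigma> T"
    and fin: "finite A" "finite T" and x: "x \<in> A"
  defines "A' \<equiv> A - {x, \<tau> x}"
  shows "card (equivariant_injections \<tau> A \<sigma> T) =
    card (equivariant_injections \<tau> A' \<sigma> T) * (card T - card A')"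
proof -
  note \<tau>D = free_involution_onD[OF \<tau>] and \<sigma>D = free_involution_onD[OF \<sigma>]
  let ?E = "equivariant_injections \<tau> A \<sigma> T" and ?E' = "equivariant_injections \<tau> A' \<sigma> T"
  \<comment> \<open>The inverse of \<open>f \<mapsto> (restrict f A', f x)\<close>: it puts
    \<open>t\<close> at \<open>x\<close> and the forced value at \<open>\<tau> x\<close>.\<close>
  define ext where
    "ext = (\<lambda>(g, t). \<lambda>y\<in>A. if y = x then t else if y = \<tau> x then \<sigma> t else (g :: 'a \<Rightarrow> 'b) y)"
  have \<tau>A': "\<tau> y \<in> A'" if "y \<in> A'" for y
    using that free_involution_onD(1)[OF free_involution_on_remove[OF \<tau> x]] by (simp add: A'_def)
  have A: "A = insert x (insert (\<tau> x) A')" using \<tau>D(1)[OF x] x by (auto simp: A'_def)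
  have xA': "x \<notin> A'" "\<tau> x \<notin> A'" "A' \<subseteq> A" by (auto simp: A'_def)
  have "bij_betw (\<lambda>f. (restrict f A', f x)) ?E (SIGMA g:?E'. T - g ` A')"
  proof (rule bij_betw_byWitness[where f' = ext])
    show "\<forall>f\<in>?E. ext (restrict f A', f x) = f"
    proof
      fix f assume f: "f \<in> ?E"
      then have fE: "f \<in> equivariant_maps \<tau> A \<sigma> T" by (simp add: equivariant_injections_def)
      show "ext (restrict f A', f x) = f"
        using equivariant_mapsD(3)[OF fE x] PiE_arb[OF equivariant_mapsD(1)[OF fE]] A
        by (auto simp: ext_def fun_eq_iff)
    qed
    show "\<forall>p\<in>SIGMA g:?E'. T - g ` A'. (restrict (ext p) A', ext p x) = p"
    proof clarify
      fix g t assume g: "g \<in> ?E'" and t: "t \<in> T" "t \<notin> g ` A'"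
      then have gE: "g \<in> equivariant_maps \<tau> A' \<sigma> T" by (simp add: equivariant_injections_def)
      show "restrict (ext (g, t)) A' = g \<and> ext (g, t) x = t"
        using x PiE_arb[OF equivariant_mapsD(1)[OF gE]] xA'
        by (auto simp: ext_def fun_eq_iff A)
    qed
    show "(\<lambda>f. (restrict f A', f x)) ` ?E \<subseteq> (SIGMA g:?E'. T - g ` A')"
    proof clarify
      fix f assume f: "f \<in> ?E"
      then have fE: "f \<in> equivariant_maps \<tau> A \<sigma> T" and inj: "inj_on f A"
        by (auto simp: equivariant_injections_def)
      have "restrict f A' \<in> ?E'"
        using \<tau>A' xA'(3) equivariant_mapsD[OF fE] inj_on_subset[OF inj xA'(3)]
        by (auto simp: equivariant_injections_def equivariant_maps_def inj_on_restrict_eq)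
      moreover have "f x \<notin> f ` A'" using inj x xA' by (auto simp: inj_on_def)
      ultimately show "restrict f A' \<in> ?E' \<and> f x \<in> T - restrict f A' ` A'"
        using equivariant_mapsD(2)[OF fE x] by auto
    qed
    show "ext ` (SIGMA g:?E'. T - g ` A') \<subseteq> ?E"
    proof clarify
      fix g t assume g: "g \<in> ?E'" and t: "t \<in> T" "t \<notin> g ` A'"
      then have gE: "g \<in> equivariant_maps \<tau> A' \<sigma> T" and inj: "inj_on g A'"
        by (auto simp: equivariant_injections_def)
      note gD = equivariant_mapsD[OF gE]
      have st: "\<sigma> t \<notin> g ` A'"
      proof
        assume "\<sigma> t \<in> g ` A'"
        then obtain y where "y \<in> A'" "g y = \<sigma> t" by auto
        then have "g (\<tau> y) = t" "\<tau> y \<in> A'" using gD \<sigma>D t \<tau>A' by auto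
        then show False using t by auto
      qed
      have ne: "\<tau> x \<noteq> x" "\<tau> (\<tau> x) = x" "\<tau> x \<in> A" using \<tau>D[OF x] by auto
      have tt: "\<sigma> t \<noteq> t" "\<sigma> (\<sigma> t) = t" "\<sigma> t \<in> T" using \<sigma>D[OF t(1)] by auto
      have ex: "ext (g, t) x = t" "ext (g, t) (\<tau> x) = \<sigma> t" "\<And>y. y \<in> A' \<Longrightarrow> ext (g, t) y = g y"
        using ne x xA' by (auto simp: ext_def)
      have "inj_on (ext (g, t)) A' = inj_on g A'" by (rule inj_on_cong) (simp add: ex)
      moreover have "ext (g, t) ` A' = g ` A'" by (rule image_cong) (simp_all add: ex)
      ultimately have "inj_on (ext (g, t)) A"
        unfolding A using xA' ne tt t st inj ex
        by simp
      moreover have "ext (g, t) \<in> A \<rightarrow>\<^sub>E T"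
      proof (rule PiE_I)
        show "ext (g, t) y \<in> T" if "y \<in> A" for y
          using that ex gD(2) t tt unfolding A by auto
        show "ext (g, t) y = undefined" if "y \<notin> A" for y
          using that by (simp add: ext_def)
      qed
      moreover have "ext (g, t) (\<tau> y) = \<sigma> (ext (g, t) y)" if "y \<in> A" for y
        using that ex ne tt gD(3) \<tau>A' unfolding A by auto
      ultimately show "ext (g, t) \<in> ?E"
        by (simp add: equivariant_injections_def equivariant_maps_def)
    qed
  qed
  then have "card ?E = card (SIGMA g:?E'. T - g ` A')" by (rule bij_betw_same_card)
  also have "\<dots> = (\<Sum>g\<in>?E'. card (T - g ` A'))"
    using fin by (intro card_SigmaI) (auto simp: finite_equivariant_injections A'_def)
  also have "\<dots> = (\<Sum>g\<in>?E'. card T - card A')"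
  proof (rule sum.cong)
    fix g assume "g \<in> ?E'"
    then have "inj_on g A'" "g ` A' \<subseteq> T"
      by (auto simp: equivariant_injections_def equivariant_maps_def)
    then show "card (T - g ` A') = card T - card A'"
      using fin by (subst card_Diff_subset) (auto simp: A'_def card_image finite_subset)
  qed simp
  finally show ?thesis by simp
qed

text \<open>Orbits are removed one at a time. Each lowers \<open>card A\<close> by 2 and contributes
  \<open>card T - card A'\<close>, the last factor of the product. If \<open>T\<close> is too small,
  both sides vanish, because \<open>card T\<close> is even and some factor is 0.\<close>

lemma card_equivariant_injections:
  assumes "free_involution_on \<tau> A" "free_involution_on \<sigma> T" "finite A" "finite T"
  shows "even (card A) \<and> real (card (equivariant_injections \<tau> A \<sigma> T)) =
    (\<Prod>i<card A div 2. real (card T) - 2 * real i)"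
  using assms(1,3)
proof (induction "card A" arbitrary: A rule: less_induct)
  case less
  note \<tau>D = free_involution_onD[OF less.prems(1)]
  show ?case
  proof (cases "A = {}")
    case True
    then show ?thesis by (auto simp: equivariant_injections_def equivariant_maps_def)
  next
    case False
    then obtain x where x: "x \<in> A" by auto
    define A' where "A' = A - {x, \<tau> x}"
    have c: "card A = card A' + 2"
    proof -
      have "A = insert x (insert (\<tau> x) A')" using \<tau>D(1)[OF x] x by (auto simp: A'_def)
      moreover have "x \<notin> insert (\<tau> x) A'" "\<tau> x \<notin> A'" "finite A'"
        using \<tau>D(3)[OF x] less.prems by (auto simp: A'_def)
      ultimately show ?thesis by (metis card_insert_disjoint finite_insert add_2_eq_Suc')
    qed
    have "free_involution_on \<tau> A'"
      unfolding A'_def by (rule free_involution_on_remove[OF less.prems(1) x])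
    then have IH: "even (card A')" "real (card (equivariant_injections \<tau> A' \<sigma> T)) =
        (\<Prod>i<card A' div 2. real (card T) - 2 * real i)"
      using less.hyps[of A'] c less.prems by (auto simp: A'_def)
    have "real (card (equivariant_injections \<tau> A \<sigma> T)) =
        real (card (equivariant_injections \<tau> A' \<sigma> T)) * real (card T - card A')"
      using card_equivariant_injections_remove[OF less.prems(1) assms(2) less.prems(2) assms(4) x]
      by (simp add: A'_def)
    \<comment> \<open>Truncated and real subtraction agree once \<open>A'\<close> injects into
      \<open>T\<close>; otherwise the first factor is 0.\<close>
    also have "\<dots> = real (card (equivariant_injections \<tau> A' \<sigma> T)) * (real (card T) - real (card A'))"
    proof (cases "equivariant_injections \<tau> A' \<sigma> T = {}")
      case False
      then obtain g where "inj_on g A'" "g ` A' \<subseteq> T"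
        by (auto simp: equivariant_injections_def equivariant_maps_def)
      then have "card A' \<le> card T" using assms(4) by (rule card_inj_on_le)
      then show ?thesis by (simp add: of_nat_diff)
    qed simp
    also have "\<dots> = (\<Prod>i<card A div 2. real (card T) - 2 * real i)"
      using IH c by (auto elim!: evenE)
    finally show ?thesis using IH c by simp
  qed
qed

section \<open>Fibre partitions of equivariant maps\<close>

text \<open>Indexing the fibres by points of \<open>A\<close> rather than by values leaves out the
  empty ones.\<close>

definition fibres :: "'a set \<Rightarrow> ('a \<Rightarrow> 'b) \<Rightarrow> 'a set set" where
  "fibres A f = (\<lambda>x. {y \<in> A. f y = f x}) ` A"

lemma partition_on_fibres: "partition_on A (fibres A f)"
  by (rule partition_onI) (auto simp: fibres_def disjnt_def)

lemma fibres_cong: "(\<And>x. x \<in> A \<Longrightarrow> f x = g x) \<Longrightarrow> fibres A f = fibres A g"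
  unfolding fibres_def by (intro image_cong) auto

text \<open>Applied to a joint map, this turns a meet equal to \<open>B_bottom n\<close> into
  injectivity.\<close>

lemma fibres_eq_singletons_iff: "fibres A f = (\<lambda>x. {x}) ` A \<longleftrightarrow> inj_on f A"
proof
  assume *: "fibres A f = (\<lambda>x. {x}) ` A"
  show "inj_on f A"
  proof (rule inj_onI)
    fix x y assume xy: "x \<in> A" "y \<in> A" "f x = f y"
    then have "{z \<in> A. f z = f x} \<in> (\<lambda>x. {x}) ` A" unfolding *[symmetric] by (auto simp: fibres_def)
    then obtain z where "{z \<in> A. f z = f x} = {z}" by auto
    moreover have "x \<in> {z \<in> A. f z = f x}" "y \<in> {z \<in> A. f z = f x}" using xy by auto
    ultimately show "x = y" by auto
  qed
next
  assume "inj_on f A"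
  then show "fibres A f = (\<lambda>x. {x}) ` A"
    unfolding fibres_def by (intro image_cong) (auto simp: inj_on_def)
qed

text \<open>A map with fibre partition \<open>P\<close> is constant on each block and separates
  distinct blocks, so it factors uniquely through an injection on \<open>P\<close>. Equivariance
  passes to the action of \<open>\<tau>\<close> on blocks.\<close>

lemma card_equivariant_maps_fibres:
  assumes \<tau>: "\<And>x. x \<in> A \<Longrightarrow> \<tau> x \<in> A" and P: "partition_on A P"
    and \<tau>P: "\<And>B. B \<in> P \<Longrightarrow> \<tau> ` B \<in> P"
  shows "card {f \<in> equivariant_maps \<tau> A \<sigma> T. fibres A f = P} =
    card (equivariant_injections (image \<tau>) P \<sigma> T)"
proof -
  \<comment> \<open>\<open>blk\<close> is the projection of \<open>A\<close> onto \<open>P\<close>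
    and \<open>rep\<close>, below, a section of it. The bijection composes with \<open>rep\<close>,
    its inverse with \<open>blk\<close>.\<close>
  define blk where "blk x = (THE B. B \<in> P \<and> x \<in> B)" for x
  have blk_eq: "blk x = B" if "B \<in> P" "x \<in> B" for x B
    unfolding blk_def using that partition_onD2[OF P] by (intro the_equality) (auto simp: disjoint_def)
  have blk: "blk x \<in> P" "x \<in> blk x" if "x \<in> A" for x
    using that partition_onD1[OF P] blk_eq by (metis UnionE)+
  have sub: "x \<in> A" if "B \<in> P" "x \<in> B" for B x using that partition_onD1[OF P] by auto
  have ne: "B \<noteq> {}" if "B \<in> P" for B using that partition_onD3[OF P] by auto
  define rep where "rep B = (SOME x. x \<in> B)" for B :: "'a set"
  have rep: "rep B \<in> B" if "B \<in> P" for B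
    unfolding rep_def using ne[OF that] by (auto intro: someI)
  have blk\<tau>: "blk (\<tau> x) = \<tau> ` blk x" if "x \<in> A" for x
    using blk[OF that] \<tau>P by (intro blk_eq) auto
  let ?L = "{f \<in> equivariant_maps \<tau> A \<sigma> T. fibres A f = P}"
  have fib: "f x = f y \<longleftrightarrow> blk x = blk y" if f: "f \<in> ?L" and xy: "x \<in> A" "y \<in> A" for f x y
  proof -
    have "fibres A f = P" using f by simp
    then have "{z \<in> A. f z = f x} \<in> P" using xy by (auto simp: fibres_def)
    then have "blk x = {z \<in> A. f z = f x}" using xy by (intro blk_eq) auto
    then show ?thesis using blk blk_eq xy by (metis (mono_tags, lifting) mem_Collect_eq)
  qed
  have "bij_betw (\<lambda>f. \<lambda>B\<in>P. f (rep B)) ?L (equivariant_injections (image \<tau>) P \<sigma> T)"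
  proof (rule bij_betw_byWitness[where f' = "\<lambda>g. \<lambda>x\<in>A. g (blk x)"])
    show "\<forall>f\<in>?L. (\<lambda>x\<in>A. (\<lambda>B\<in>P. f (rep B)) (blk x)) = f"
    proof
      fix f assume f: "f \<in> ?L"
      have "f (rep (blk x)) = f x" if "x \<in> A" for x
        using fib[OF f, of "rep (blk x)" x] that rep[OF blk(1)[OF that]] blk[OF that] sub blk_eq by blast
      moreover have "f x = undefined" if "x \<notin> A" for x
        using f that by (auto simp: equivariant_maps_def)
      ultimately show "(\<lambda>x\<in>A. (\<lambda>B\<in>P. f (rep B)) (blk x)) = f"
        using blk by (auto simp: fun_eq_iff)
    qed
    show "\<forall>g\<in>equivariant_injections (image \<tau>) P \<sigma> T. (\<lambda>B\<in>P. (\<lambda>x\<in>A. g (blk x)) (rep B)) = g"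
    proof
      fix g assume "g \<in> equivariant_injections (image \<tau>) P \<sigma> T"
      then have "g B = undefined" if "B \<notin> P" for B
        using that by (auto simp: equivariant_injections_def equivariant_maps_def)
      moreover have "rep B \<in> A" "blk (rep B) = B" if "B \<in> P" for B
        using rep[OF that] sub blk_eq that by auto
      ultimately show "(\<lambda>B\<in>P. (\<lambda>x\<in>A. g (blk x)) (rep B)) = g"
        by (auto simp: fun_eq_iff)
    qed
    show "(\<lambda>f. \<lambda>B\<in>P. f (rep B)) ` ?L \<subseteq> equivariant_injections (image \<tau>) P \<sigma> T"
    proof (rule image_subsetI)
      fix f assume f: "f \<in> ?L"
      then have fE: "f \<in> equivariant_maps \<tau> A \<sigma> T" by simp
      have repA: "rep B \<in> A" "blk (rep B) = B" if "B \<in> P" for B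
        using rep[OF that] sub blk_eq that by auto
      \<comment> \<open>The section need not commute with \<open>\<tau>\<close>, but the chosen
        point of the image block and the image of the chosen point lie in the same block, on which
        \<open>f\<close> is constant.\<close>
      have "f (rep (\<tau> ` B)) = \<sigma> (f (rep B))" if "B \<in> P" for B
      proof -
        have "f (rep (\<tau> ` B)) = f (\<tau> (rep B))"
          using fib[OF f, of "rep (\<tau> ` B)" "\<tau> (rep B)"] repA that \<tau>P \<tau> blk\<tau> by simp
        then show ?thesis using equivariant_mapsD(3)[OF fE] repA that by simp
      qed
      moreover have "inj_on (\<lambda>B. f (rep B)) P"
        using fib[OF f] repA by (intro inj_onI) metis
      ultimately show "(\<lambda>B\<in>P. f (rep B)) \<in> equivariant_injections (image \<tau>) P \<sigma> T"
        using equivariant_mapsD(2)[OF fE] repA \<tau>P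
        by (auto simp: equivariant_injections_def equivariant_maps_def inj_on_restrict_eq)
    qed
    show "(\<lambda>g. \<lambda>x\<in>A. g (blk x)) ` equivariant_injections (image \<tau>) P \<sigma> T \<subseteq> ?L"
    proof (rule image_subsetI)
      fix g assume "g \<in> equivariant_injections (image \<tau>) P \<sigma> T"
      then have gE: "g \<in> equivariant_maps (image \<tau>) P \<sigma> T" and inj: "inj_on g P"
        by (auto simp: equivariant_injections_def)
      have fibre: "{y \<in> A. g (blk y) = g (blk x)} = blk x" if "x \<in> A" for x
      proof -
        have "g (blk y) = g (blk x) \<longleftrightarrow> y \<in> blk x" if "y \<in> A" for y
          using inj_on_eq_iff[OF inj blk(1)[OF \<open>y \<in> A\<close>] blk(1)[OF \<open>x \<in> A\<close>]]
            blk that \<open>x \<in> A\<close> blk_eq by metis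
        then show ?thesis using blk[OF that] sub by auto
      qed
      have "fibres A (\<lambda>x\<in>A. g (blk x)) = blk ` A"
        by (subst fibres_cong[where g = "\<lambda>x. g (blk x)"]) (auto simp: fibres_def fibre)
      also have "\<dots> = P"
      proof (intro equalityI subsetI)
        show "B \<in> P" if "B \<in> blk ` A" for B using that blk by auto
        show "B \<in> blk ` A" if "B \<in> P" for B
          using blk_eq[OF that rep[OF that]] sub[OF that rep[OF that]] by force
      qed
      finally show "(\<lambda>x\<in>A. g (blk x)) \<in> ?L"
        using equivariant_mapsD[OF gE] blk blk\<tau> \<tau> by (auto simp: equivariant_maps_def)
    qed
  qed
  then show ?thesis by (rule bij_betw_same_card)
qed

section \<open>Negation on signed sets and on partitions without zero-block\<close>

lemma finite_pm_set: "finite (pm_set n)" and card_pm_set: "card (pm_set n) = 2 * n"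
proof -
  have *: "pm_set n = {- int n..-1} \<union> {1..int n}" by (auto simp: pm_set_def)
  show "finite (pm_set n)" by (simp add: *)
  show "card (pm_set n) = 2 * n" unfolding * by (subst card_Un_disjoint) auto
qed

lemma free_involution_pm_set: "free_involution_on uminus (pm_set n)"
  by (auto simp: free_involution_on_def pm_set_def)

text \<open>The absence of a zero-block says precisely that negation fixes no block.\<close>

lemma free_involution_B_partition:
  assumes "P \<in> B_partitions_no_zero n"
  shows "free_involution_on (image uminus) P"
  using assms
  by (auto simp: free_involution_on_def B_partitions_no_zero_def B_partition_def zero_block_def
      image_image)

text \<open>By oddness, the negative of the fibre through \<open>x\<close> is the fibre through
  \<open>- x\<close>. A fibre equal to its negative would give \<open>f x = - f x\<close>, hence the
  value 0, which is not in \<open>pm_set k\<close>.\<close>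

lemma fibres_in_B_partitions_no_zero:
  assumes f: "f \<in> equivariant_maps uminus (pm_set n) uminus (pm_set k)"
  shows "fibres (pm_set n) f \<in> B_partitions_no_zero n"
proof -
  have neg: "- x \<in> pm_set n" if "x \<in> pm_set n" for x using that by (auto simp: pm_set_def)
  have fneg: "f (- x) = - f x" if "x \<in> pm_set n" for x using equivariant_mapsD(3)[OF f that] .
  have fibre: "uminus ` {y \<in> pm_set n. f y = f x} = {y \<in> pm_set n. f y = f (- x)}"
    if x: "x \<in> pm_set n" for x
  proof
    show "uminus ` {y \<in> pm_set n. f y = f x} \<subseteq> {y \<in> pm_set n. f y = f (- x)}"
      using neg fneg x by auto
    show "{y \<in> pm_set n. f y = f (- x)} \<subseteq> uminus ` {y \<in> pm_set n. f y = f x}"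
    proof
      fix y assume "y \<in> {y \<in> pm_set n. f y = f (- x)}"
      then have "- y \<in> {y \<in> pm_set n. f y = f x}" using neg fneg x by auto
      then show "y \<in> uminus ` {y \<in> pm_set n. f y = f x}" by (metis add.inverse_inverse imageI)
    qed
  qed
  have "\<not> zero_block (fibres (pm_set n) f) B" for B
  proof
    assume "zero_block (fibres (pm_set n) f) B"
    then obtain x where x: "x \<in> pm_set n"
      "uminus ` {y \<in> pm_set n. f y = f x} = {y \<in> pm_set n. f y = f x}"
      by (auto simp: zero_block_def fibres_def)
    then have "f x = f (- x)" using fibre[OF x(1)] by blast
    then have "f x = 0" using fneg x by simp
    then show False using equivariant_mapsD(2)[OF f x(1)] by (auto simp: pm_set_def)
  qed
  moreover have "uminus ` B \<in> fibres (pm_set n) f" if "B \<in> fibres (pm_set n) f" for B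
    using that fibre neg by (auto simp: fibres_def)
  ultimately show ?thesis
    by (auto simp: B_partitions_no_zero_def B_partition_def partition_on_fibres)
qed

section \<open>Meets of fibre partitions and injectivity of the joint map\<close>

text \<open>Blocks with a common point \<open>x\<close> are the fibres through \<open>x\<close>, and
  their intersection is the fibre of the joint map through \<open>x\<close>.\<close>

lemma tuple_meet_fibres:
  assumes "r \<ge> 1"
  shows "tuple_meet r (\<lambda>i\<in>{1..r}. fibres A (F i)) = fibres A (\<lambda>x. \<lambda>i\<in>{1..r}. F i x)"
proof -
  let ?p = "\<lambda>i\<in>{1..r}. fibres A (F i)"
  have "tuple_meet r ?p = {\<Inter>t\<in>{1..r}. B t |B. \<forall>t\<in>{1..r}. B t \<in> ?p t} - {{}}"
    by (rule tuple_meet_eq[where A = A]) (simp add: partition_on_fibres)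
  also have "\<dots> = fibres A (\<lambda>x. \<lambda>i\<in>{1..r}. F i x)"
  proof (intro equalityI subsetI)
    fix X assume "X \<in> {\<Inter>t\<in>{1..r}. B t |B. \<forall>t\<in>{1..r}. B t \<in> ?p t} - {{}}"
    then obtain B where p: "\<forall>t\<in>{1..r}. B t \<in> ?p t" and X: "X = (\<Inter>t\<in>{1..r}. B t)"
      and ne: "X \<noteq> {}" by blast
    obtain x where x: "x \<in> X" using ne by blast
    have B: "B t \<in> fibres A (F t)" if "t \<in> {1..r}" for t using p that by simp
    have Bt: "B t = {y \<in> A. F t y = F t x}" "x \<in> A" if t: "t \<in> {1..r}" for t
    proof -
      have xB: "x \<in> B t" using x X t by blast
      obtain z where z: "B t = {y \<in> A. F t y = F t z}"
        using B[OF t] unfolding fibres_def by blast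
      then have "x \<in> A" "F t x = F t z" using xB by blast+
      then show "B t = {y \<in> A. F t y = F t x}" "x \<in> A" using z by simp_all
    qed
    \<comment> \<open>At least one block is intersected, which confines the intersection to
      \<open>A\<close>.\<close>
    have "1 \<in> {1..r}" using assms by simp
    then have "x \<in> A" "X = {y \<in> A. \<forall>t\<in>{1..r}. F t y = F t x}"
      using Bt unfolding X by blast+
    then show "X \<in> fibres A (\<lambda>x. \<lambda>i\<in>{1..r}. F i x)"
      unfolding fibres_def by (intro image_eqI[of _ _ x]) (auto simp: fun_eq_iff restrict_def)
  next
    fix X assume "X \<in> fibres A (\<lambda>x. \<lambda>i\<in>{1..r}. F i x)"
    then obtain x where x: "x \<in> A"
      and "X = {y \<in> A. (\<lambda>i\<in>{1..r}. F i y) = (\<lambda>i\<in>{1..r}. F i x)}"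
      by (auto simp: fibres_def)
    then have X: "X = {y \<in> A. \<forall>t\<in>{1..r}. F t y = F t x}"
      by (auto simp: fun_eq_iff restrict_def)
    then have "X = (\<Inter>t\<in>{1..r}. {y \<in> A. F t y = F t x})" using assms by auto
    then show "X \<in> {\<Inter>t\<in>{1..r}. B t |B. \<forall>t\<in>{1..r}. B t \<in> ?p t} - {{}}"
      using x X by (auto simp: fibres_def intro!: exI[of _ "\<lambda>t. {y \<in> A. F t y = F t x}"])
  qed
  finally show ?thesis .
qed

text \<open>A tuple of maps determines its tuple of fibre partitions. Hence a sum of such
  cardinalities over partition tuples is the cardinality of a union.\<close>

lemma PiE_fibres_disjoint:
  assumes "p \<in> I \<rightarrow>\<^sub>E X" "q \<in> I \<rightarrow>\<^sub>E X" "p \<noteq> q"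
  shows "(\<Pi>\<^sub>E i\<in>I. {f \<in> E i. fibres A f = p i}) \<inter> (\<Pi>\<^sub>E i\<in>I. {f \<in> E i. fibres A f = q i}) = {}"
proof (rule ccontr)
  assume "\<not> ?thesis"
  then obtain F where "F \<in> (\<Pi>\<^sub>E i\<in>I. {f \<in> E i. fibres A f = p i})"
    "F \<in> (\<Pi>\<^sub>E i\<in>I. {f \<in> E i. fibres A f = q i})"
    by blast
  then have "p i = q i" if "i \<in> I" for i using that by (auto simp: PiE_iff)
  then show False using PiE_ext[OF assms(1,2)] assms(3) by blast
qed

text \<open>For fixed \<open>k\<close>, both sides count tuples of odd maps whose fibre partitions
  intersect minimally. Such a tuple is the same as a single injective joint map, equivariant for
  pointwise negation on the product.\<close>

lemma sum_prod_card_equivariant_maps_fibres: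
  fixes k :: "nat \<Rightarrow> nat" and n :: nat
  assumes r: "r \<ge> 1"
  defines "E \<equiv> \<lambda>i. equivariant_maps uminus (pm_set n) uminus (pm_set (k i))"
  shows "(\<Sum>p\<in>min_intersecting_tuples n r. \<Prod>i=1..r. card {f \<in> E i. fibres (pm_set n) f = p i}) =
    card (equivariant_injections uminus (pm_set n)
      (\<lambda>t. \<lambda>i\<in>{1..r}. - t i) (\<Pi>\<^sub>E i\<in>{1..r}. pm_set (k i)))" (is "_ = card ?J")
proof -
  let ?M = "min_intersecting_tuples n r" and ?A = "pm_set n"
  let ?K = "\<lambda>p i. {f \<in> E i. fibres ?A f = p i}"
  have finE: "finite (E i)" for i
    by (simp add: E_def finite_equivariant_maps finite_pm_set)
  have "(\<Sum>p\<in>?M. \<Prod>i=1..r. card (?K p i)) = (\<Sum>p\<in>?M. card (\<Pi>\<^sub>E i\<in>{1..r}. ?K p i))"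
    by (simp add: card_PiE)
  also have "\<dots> = card (\<Union>p\<in>?M. \<Pi>\<^sub>E i\<in>{1..r}. ?K p i)"
  proof (rule card_UN_disjoint[symmetric])
    show "\<forall>p\<in>?M. finite (\<Pi>\<^sub>E i\<in>{1..r}. ?K p i)"
      using finE by (intro ballI finite_PiE) auto
    show "\<forall>p\<in>?M. \<forall>q\<in>?M. p \<noteq> q \<longrightarrow>
        (\<Pi>\<^sub>E i\<in>{1..r}. ?K p i) \<inter> (\<Pi>\<^sub>E i\<in>{1..r}. ?K q i) = {}"
      by (intro ballI impI PiE_fibres_disjoint[where X = "B_partitions_no_zero n"])
         (auto simp: min_intersecting_tuples_def)
  qed (rule finite_min_intersecting_tuples)
  \<comment> \<open>The union loses track of \<open>p\<close>, but \<open>p\<close> is recovered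
    from \<open>F\<close> as its tuple of fibre partitions; only the condition on the meet remains,
    in the form of injectivity.\<close>
  also have "(\<Union>p\<in>?M. \<Pi>\<^sub>E i\<in>{1..r}. ?K p i) =
      {F \<in> \<Pi>\<^sub>E i\<in>{1..r}. E i. inj_on (\<lambda>x. \<lambda>i\<in>{1..r}. F i x) ?A}" (is "?U = ?V")
  proof (intro equalityI subsetI)
    fix F assume "F \<in> ?U"
    then obtain p where p: "p \<in> ?M" and F: "F \<in> (\<Pi>\<^sub>E i\<in>{1..r}. ?K p i)" by auto
    have pe: "p \<in> {1..r} \<rightarrow>\<^sub>E B_partitions_no_zero n"
      using p by (simp add: min_intersecting_tuples_def)
    have "p = (\<lambda>i\<in>{1..r}. fibres ?A (F i))"
      using F PiE_arb[OF pe] by (fastforce simp: fun_eq_iff PiE_iff)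
    then have "fibres ?A (\<lambda>x. \<lambda>i\<in>{1..r}. F i x) = B_bottom n"
      using tuple_meet_fibres[OF r, of ?A F] p by (simp add: min_intersecting_tuples_def)
    then have "inj_on (\<lambda>x. \<lambda>i\<in>{1..r}. F i x) ?A"
      by (simp only: B_bottom_def fibres_eq_singletons_iff)
    then show "F \<in> ?V" using F by (auto simp: PiE_iff)
  next
    fix F assume F: "F \<in> ?V"
    define p where "p = (\<lambda>i\<in>{1..r}. fibres ?A (F i))"
    have "tuple_meet r p = B_bottom n"
      using F unfolding p_def tuple_meet_fibres[OF r] B_bottom_def fibres_eq_singletons_iff by simp
    moreover have "p i \<in> B_partitions_no_zero n" if "i \<in> {1..r}" for i
      using that F fibres_in_B_partitions_no_zero[of "F i" n "k i"] by (auto simp: p_def E_def PiE_iff)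
    ultimately have "p \<in> ?M"
      by (auto simp: min_intersecting_tuples_def p_def)
    moreover have "F \<in> (\<Pi>\<^sub>E i\<in>{1..r}. ?K p i)" using F by (auto simp: p_def PiE_iff)
    ultimately show "F \<in> ?U" by blast
  qed
  also have "card ?V = card ?J"
  proof -
    \<comment> \<open>Both maps exchange the two arguments; the restrictions at both levels keep the
      results extensional.\<close>
    let ?\<phi> = "\<lambda>F. \<lambda>x\<in>?A. \<lambda>i\<in>{1..r}. F i x" and ?\<psi> = "\<lambda>G. \<lambda>i\<in>{1..r}. \<lambda>x\<in>?A. G x i"
    have "bij_betw ?\<phi> ?V ?J"
    proof (rule bij_betw_byWitness[where f' = ?\<psi>])
      have neg: "- x \<in> ?A" if "x \<in> ?A" for x using that by (auto simp: pm_set_def)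
      have V: "F i \<in> E i" if "F \<in> ?V" "i \<in> {1..r}" for F i
        using that by (auto simp: PiE_iff)
      have J: "G \<in> ?A \<rightarrow>\<^sub>E (\<Pi>\<^sub>E i\<in>{1..r}. pm_set (k i))" "inj_on G ?A"
        "\<And>x. x \<in> ?A \<Longrightarrow> G (- x) = (\<lambda>i\<in>{1..r}. - G x i)" if "G \<in> ?J" for G
        using that by (auto simp: equivariant_injections_def equivariant_maps_def)
      show "\<forall>F\<in>?V. ?\<psi> (?\<phi> F) = F"
      proof
        fix F assume F: "F \<in> ?V"
        then have Fr: "F \<in> (\<Pi>\<^sub>E i\<in>{1..r}. E i)" by simp
        have "restrict (F i) ?A = F i" if "i \<in> {1..r}" for i
          using equivariant_mapsD(1)[OF V[OF F that, unfolded E_def]] by (rule PiE_restrict)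
        then have "?\<psi> (?\<phi> F) = restrict F {1..r}"
          by (intro restrict_ext) (simp cong: restrict_cong)
        then show "?\<psi> (?\<phi> F) = F" by (simp only: PiE_restrict[OF Fr])
      qed
      have GA: "?\<phi> (?\<psi> G) = G" if G: "G \<in> ?J" for G
      proof -
        have "restrict (G x) {1..r} = G x" if "x \<in> ?A" for x
          using PiE_mem[OF J(1)[OF G] that] by (rule PiE_restrict)
        then have "?\<phi> (?\<psi> G) = restrict G ?A"
          by (intro restrict_ext) (simp cong: restrict_cong)
        then show ?thesis by (simp only: PiE_restrict[OF J(1)[OF G]])
      qed
      then show "\<forall>G\<in>?J. ?\<phi> (?\<psi> G) = G" by blast
      show "?\<phi> ` ?V \<subseteq> ?J"
      proof (rule image_subsetI)
        fix F assume F: "F \<in> ?V"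
        note FD = equivariant_mapsD[OF V[OF F, unfolded E_def]]
        have "?\<phi> F \<in> ?A \<rightarrow>\<^sub>E (\<Pi>\<^sub>E i\<in>{1..r}. pm_set (k i))" using FD(2) by auto
        moreover have "?\<phi> F (- x) = (\<lambda>i\<in>{1..r}. - ?\<phi> F x i)" if "x \<in> ?A" for x
          using FD(3) that neg[OF that] by (auto simp: fun_eq_iff)
        ultimately show "?\<phi> F \<in> ?J"
          using F by (simp add: equivariant_injections_def equivariant_maps_def inj_on_restrict_eq)
      qed
      show "?\<psi> ` ?J \<subseteq> ?V"
      proof (rule image_subsetI)
        fix G assume G: "G \<in> ?J"
        have "(\<lambda>x\<in>?A. G x i) \<in> E i" if i: "i \<in> {1..r}" for i
          using J(3)[OF G] neg i PiE_mem[OF PiE_mem[OF J(1)[OF G]] i]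
          by (auto simp: E_def equivariant_maps_def)
        moreover have "inj_on (\<lambda>x. \<lambda>i\<in>{1..r}. ?\<psi> G i x) ?A"
          using J(2)[OF G] GA[OF G] by (metis (no_types, lifting) inj_on_restrict_eq)
        ultimately show "?\<psi> G \<in> ?V" by simp
      qed
    qed
    then show ?thesis by (rule bij_betw_same_card)
  qed
  finally show ?thesis .
qed

section \<open>Exponential weights and products of infinite sums\<close>

text \<open>Converts the step-2 products that count equivariant injections into falling factorials;
  this is the source of the factor \<open>2 ^ n\<close> in the final formula.\<close>

lemma falling_fact_double: "(\<Prod>i<n. 2 * x - 2 * real i) = 2 ^ n * falling_fact x n"
  by (simp add: falling_fact_def prod.distrib del: right_diff_distrib_numeral flip: right_diff_distrib)

text \<open>The terms with \<open>k < m\<close> vanish; the term \<open>k = m + j\<close> is \<open>(1/2)\<^sup>j / j!\<close>.\<close>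

lemma has_sum_prod_falling_div_double_fact:
  "((\<lambda>k. (\<Prod>i<m. 2 * real k - 2 * real i) / real (double_fact (2 * k))) has_sum exp (1 / 2)) UNIV"
proof -
  have summand: "(\<Prod>i<m. 2 * real (m + j) - 2 * real i) / real (double_fact (2 * (m + j))) =
      (1 / 2) ^ j /\<^sub>R fact j" for j
  proof -
    have "(\<Prod>i<m. 2 * real (m + j) - 2 * real i) = 2 ^ m * (\<Prod>i<m. real (m + j) - real i)"
      using falling_fact_double[where x = "real (m + j)"] by (simp only: falling_fact_def)
    also have "(\<Prod>i<m. real (m + j) - real i) * fact j = fact (m + j)"
    proof (induction m)
      case (Suc m)
      \<comment> \<open>Splitting off \<open>i = 0\<close> and shifting the index leaves the product
        for \<open>m\<close> with the same \<open>j\<close>.\<close>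
      have "(\<Prod>i<Suc m. real (Suc m + j) - real i) = real (Suc m + j) * (\<Prod>i<m. real (m + j) - real i)"
        by (subst prod.lessThan_Suc_shift) simp
      then have "(\<Prod>i<Suc m. real (Suc m + j) - real i) * fact j = real (Suc m + j) * fact (m + j)"
        using Suc by (simp only: mult.assoc)
      then show ?case by simp
    qed simp
    then have "(\<Prod>i<m. real (m + j) - real i) = fact (m + j) / fact j" by (simp add: field_simps)
    finally show ?thesis
      unfolding double_fact_even by (simp add: power_add field_simps power_divide)
  qed
  have "((\<lambda>j. (1 / 2) ^ j /\<^sub>R fact j) has_sum exp (1 / 2 :: real)) UNIV"
    by (rule sums_nonneg_imp_has_sum[OF exp_converges]) simp
  then have "((\<lambda>k. (\<Prod>i<m. 2 * real k - 2 * real i) / real (double_fact (2 * k))) has_sum exp (1 / 2))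
      (range (\<lambda>j. m + j))"
    by (subst has_sum_reindex) (simp, simp only: o_def summand)
  then show ?thesis
  proof (rule has_sum_cong_neutral[THEN iffD1, rotated -1])
    fix k assume "k \<in> UNIV - range (\<lambda>j. m + j)"
    then have "k < m" by (metis DiffD2 le_Suc_ex not_le rangeI)
    then show "(\<Prod>i<m. 2 * real k - 2 * real i) / real (double_fact (2 * k)) = 0" by auto
  qed auto
qed

text \<open>By induction on \<open>I\<close>: via \<open>g(x := y)\<close>, the functions on
  \<open>insert x I\<close> correspond to pairs of a value \<open>y\<close> at \<open>x\<close> and
  a function \<open>g\<close> on \<open>I\<close>, and the double sum is evaluated by rows.\<close>

lemma has_sum_prod_PiE_nonneg:
  fixes f :: "'a \<Rightarrow> 'b \<Rightarrow> real"
  assumes "finite I"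
    and "\<And>i. i \<in> I \<Longrightarrow> (f i has_sum s i) (B i)"
    and "\<And>i b. i \<in> I \<Longrightarrow> b \<in> B i \<Longrightarrow> f i b \<ge> 0"
  shows "((\<lambda>g. \<Prod>i\<in>I. f i (g i)) has_sum (\<Prod>i\<in>I. s i)) (\<Pi>\<^sub>E i\<in>I. B i)"
  using assms
proof (induction I)
  case empty
  then show ?case by (simp add: has_sum_finiteI)
next
  case (insert x I)
  let ?F = "\<lambda>g. \<Prod>i\<in>I. f i (g i)"
  have IH: "(?F has_sum (\<Prod>i\<in>I. s i)) (Pi\<^sub>E I B)" using insert by auto
  have row: "((\<lambda>g. f x y * ?F g) has_sum f x y * (\<Prod>i\<in>I. s i)) (Pi\<^sub>E I B)" for y
    by (rule has_sum_cmult_right[OF IH])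
  have col: "((\<lambda>y. f x y * (\<Prod>i\<in>I. s i)) has_sum s x * (\<Prod>i\<in>I. s i)) (B x)"
    using insert.prems by (intro has_sum_cmult_left) auto
  \<comment> \<open>Here nonnegativity enters: summable row sums of nonnegative terms give
    summability over the product, which evaluation by rows requires.\<close>
  have summ: "(\<lambda>(y, g). f x y * ?F g) summable_on (B x \<times> Pi\<^sub>E I B)"
  proof (rule summable_on_SigmaI)
    show "((\<lambda>g. case (y, g) of (y, g) \<Rightarrow> f x y * ?F g) has_sum f x y * (\<Prod>i\<in>I. s i)) (Pi\<^sub>E I B)" for y
      using row by simp
    show "(\<lambda>y. f x y * (\<Prod>i\<in>I. s i)) summable_on B x" using col by (rule has_sum_imp_summable)
    show "(case (y, g) of (y, g) \<Rightarrow> f x y * ?F g) \<ge> 0" if "y \<in> B x" "g \<in> Pi\<^sub>E I B" for y g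
      using that insert.prems(2) by (auto intro!: mult_nonneg_nonneg prod_nonneg)
  qed
  have "((\<lambda>(y, g). f x y * ?F g) has_sum s x * (\<Prod>i\<in>I. s i)) (B x \<times> Pi\<^sub>E I B)"
    using row col summ by (intro has_sum_SigmaI[where g = "\<lambda>y. f x y * (\<Prod>i\<in>I. s i)"]) auto
  also have "?this \<longleftrightarrow> (((\<lambda>g. \<Prod>i\<in>insert x I. f i (g i)) \<circ> (\<lambda>(y, g). g(x := y)))
      has_sum s x * (\<Prod>i\<in>I. s i)) (B x \<times> Pi\<^sub>E I B)"
    using insert.hyps by (intro has_sum_cong) (auto intro!: prod.cong)
  finally show ?case
    using insert.hyps inj_combinator[OF insert.hyps(2), of B]
    by (simp add: PiE_insert_eq has_sum_reindex)
qed

lemma has_sum_finite_sum: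
  fixes f :: "'a \<Rightarrow> 'b \<Rightarrow> 'c::topological_comm_monoid_add"
  assumes "finite I" "\<And>i. i \<in> I \<Longrightarrow> (f i has_sum s i) A"
  shows "((\<lambda>x. \<Sum>i\<in>I. f i x) has_sum (\<Sum>i\<in>I. s i)) A"
  using assms by (induction I) (simp_all add: has_sum_add)

section \<open>Double counting of weighted tuples of odd maps\<close>

text \<open>Extensional index functions represent each tuple of \<open>k\<close>-values once.
  Summability is asserted as well because the infinite sum of a non-summable family is 0 by
  convention.\<close>

theorem theorem3p4:
  fixes n r :: nat
  assumes "n \<ge> 1" and "r \<ge> 2"
  shows "(\<lambda>k. falling_fact (2 ^ (r - 1) * (\<Prod>i=1..r. real (k i))) n
              / (\<Prod>i=1..r. real (double_fact (2 * k i))))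
           summable_on ({1..r} \<rightarrow>\<^sub>E (UNIV :: nat set))
    \<and> real (N_D n r) = 2 ^ n / exp (real r / 2) *
        (\<Sum>\<^sub>\<infinity>k\<in>({1..r} \<rightarrow>\<^sub>E (UNIV :: nat set)).
           falling_fact (2 ^ (r - 1) * (\<Prod>i=1..r. real (k i))) n
              / (\<Prod>i=1..r. real (double_fact (2 * k i))))"
proof -
  let ?T = "{1..r} \<rightarrow>\<^sub>E (UNIV :: nat set)" and ?M = "min_intersecting_tuples n r"
  let ?S = "\<lambda>k. falling_fact (2 ^ (r - 1) * (\<Prod>i=1..r. real (k i))) n
              / (\<Prod>i=1..r. real (double_fact (2 * k i)))"
  define c where "c P k = card {f \<in> equivariant_maps uminus (pm_set n) uminus (pm_set k).
    fibres (pm_set n) f = P}" for P k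
  define q where "q P k = real (c P k) / real (double_fact (2 * k))" for P k
  have r: "r \<ge> 1" using assms by simp
  have neg: "- x \<in> pm_set n" if "x \<in> pm_set n" for x n using that by (auto simp: pm_set_def)
  have q: "(q P has_sum exp (1 / 2)) UNIV" if P: "P \<in> B_partitions_no_zero n" for P
  proof -
    have part: "partition_on (pm_set n) P" "\<And>B. B \<in> P \<Longrightarrow> uminus ` B \<in> P"
      using P by (auto simp: B_partitions_no_zero_def B_partition_def)
    have "finite P" using finite_elements[OF finite_pm_set part(1)] .
    then have "real (c P k) = (\<Prod>i<card P div 2. 2 * real k - 2 * real i)" for k
      using card_equivariant_injections[OF free_involution_B_partition[OF P] free_involution_pm_set _ finite_pm_set]
        card_equivariant_maps_fibres[OF neg part, of uminus "pm_set k"] by (simp add: c_def card_pm_set)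
    then show ?thesis
      using has_sum_prod_falling_div_double_fact[of "card P div 2"] by (simp add: q_def[abs_def])
  qed
  \<comment> \<open>Each minimally intersecting tuple has total weight \<open>exp (1 / 2)\<close> to
    the power \<open>r\<close>, whatever its numbers of blocks, so summing over all of them gives
    \<open>N_D n r * exp (real r / 2)\<close>.\<close>
  have "((\<lambda>k. \<Prod>i=1..r. q (p i) (k i)) has_sum exp (real r / 2)) ?T" if p: "p \<in> ?M" for p
  proof -
    have "((\<lambda>k. \<Prod>i=1..r. q (p i) (k i)) has_sum (\<Prod>i=1..r. exp (1 / 2))) ?T"
    proof (rule has_sum_prod_PiE_nonneg)
      show "(q (p i) has_sum exp (1 / 2)) UNIV" if "i \<in> {1..r}" for i
        using p that by (intro q) (auto simp: min_intersecting_tuples_def)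
    qed (simp_all add: q_def)
    then show ?thesis by (simp add: exp_of_nat_mult[symmetric])
  qed
  then have "((\<lambda>k. \<Sum>p\<in>?M. \<Prod>i=1..r. q (p i) (k i)) has_sum (\<Sum>p\<in>?M. exp (real r / 2))) ?T"
    by (intro has_sum_finite_sum finite_min_intersecting_tuples)
  \<comment> \<open>The other evaluation fixes \<open>k\<close> first: the numerators add up to the
    number of equivariant injections into the product of the sets
    \<open>pm_set (k i)\<close>.\<close>
  moreover have "(\<Sum>p\<in>?M. \<Prod>i=1..r. q (p i) (k i)) = 2 ^ n * ?S k" for k
  proof -
    let ?J = "equivariant_injections uminus (pm_set n)
      (\<lambda>t. \<lambda>i\<in>{1..r}. - t i) (\<Pi>\<^sub>E i\<in>{1..r}. pm_set (k i))"
    have inv: "free_involution_on (\<lambda>t. \<lambda>i\<in>{1..r}. - t i) (\<Pi>\<^sub>E i\<in>{1..r}. pm_set (k i))"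
      unfolding free_involution_on_def
    proof (intro ballI conjI)
      fix t assume t: "t \<in> (\<Pi>\<^sub>E i\<in>{1..r}. pm_set (k i))"
      show "(\<lambda>i\<in>{1..r}. - t i) \<in> (\<Pi>\<^sub>E i\<in>{1..r}. pm_set (k i))"
        using t neg by (auto simp: PiE_iff)
      show "(\<lambda>i\<in>{1..r}. - (\<lambda>i\<in>{1..r}. - t i) i) = t"
        using PiE_arb[OF t] by (auto simp: fun_eq_iff)
      \<comment> \<open>One nonzero coordinate suffices for negation to move \<open>t\<close>; an
        empty index set would leave a fixed point.\<close>
      have "t 1 \<noteq> 0" using PiE_mem[OF t, of 1] r by (auto simp: pm_set_def)
      then show "(\<lambda>i\<in>{1..r}. - t i) \<noteq> t" using r by (auto dest!: fun_cong[of _ _ 1])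
    qed
    have J: "real (card ?J) = (\<Prod>i<n. real (card (\<Pi>\<^sub>E i\<in>{1..r}. pm_set (k i))) - 2 * real i)"
      using card_equivariant_injections[OF free_involution_pm_set inv finite_pm_set]
      by (simp add: finite_pm_set card_pm_set finite_PiE)
    have "real (card (\<Pi>\<^sub>E i\<in>{1..r}. pm_set (k i))) = 2 ^ r * (\<Prod>i=1..r. real (k i))"
      by (simp add: card_PiE card_pm_set prod.distrib)
    \<comment> \<open>The size of the product is written as \<open>2 * x\<close> to fit
      \<open>falling_fact_double\<close>; this turns \<open>2 ^ r\<close> into
      \<open>2 ^ (r - 1)\<close>.\<close>
    also have "\<dots> = 2 * (2 ^ (r - 1) * (\<Prod>i=1..r. real (k i)))"
      using r by (cases r) auto
    finally have "real (card ?J) = 2 ^ n * falling_fact (2 ^ (r - 1) * (\<Prod>i=1..r. real (k i))) n"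
      using J falling_fact_double by simp
    moreover have "(\<Sum>p\<in>?M. \<Prod>i=1..r. q (p i) (k i)) =
        real (\<Sum>p\<in>?M. \<Prod>i=1..r. c (p i) (k i)) / (\<Prod>i=1..r. real (double_fact (2 * k i)))"
      by (simp add: q_def prod_dividef sum_divide_distrib)
    ultimately show ?thesis
      unfolding c_def sum_prod_card_equivariant_maps_fibres[OF r] by simp
  qed
  ultimately have "((\<lambda>k. 2 ^ n * ?S k) has_sum real (N_D n r) * exp (real r / 2)) ?T"
    by (simp add: N_D_def)
  then have "(?S has_sum real (N_D n r) * exp (real r / 2) / 2 ^ n) ?T"
    by (subst (asm) has_sum_cmult_right_iff) auto
  then show ?thesis by (auto simp: has_sum_iff)
qed

end
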